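(* There exists a universal constant $K>0$ such that the following holds. For every integer $n_0\ge 1$, every probability measure $\mu$ on $\mathbb{R}$ for which $\int_{\mathbb{R}} |x|^{n_0}\,d\mu(x)<\infty$, and every $x_0\in\mathbb{R}$, $$\big|\mu[x_0,+\infty)-\sigma_2[x_0,+\infty)\big|\le K\left\{\frac{\rho(x_0;n_0)}{n_0}+\rho(x_0;n_0)^{1/2}\sum_{n=1}^{n_0}\frac1n\left|\int_{\mathbb{R}}U_n(x)\,d\mu(x)\right|\right\},$$ where $\rho(x;n_0)=\max(1-|x|,\,n_0^{-2})$.
   Context: $\sigma_2$ is the probability measure on $\mathbb{R}$ (semicircle law on $[-1,1]$) given by $d\sigma_2(x)=\frac2\pi(1-x^2)_+^{1/2}\,dx$, i.e. with density $\frac{2}{\pi}\sqrt{1-x^2}$ on $[-1,1]$ and $0$ elsewhere. $U_n$ is the Chebyshev polynomial of the second kind, defined by $U_n(\cos\theta)=\frac{\sin((n+1)\theta)}{\sin\theta}$; these polynomials are orthogonal with respect to $\sigma_2$. *)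

theory Defs
  imports "HOL-Probability.Probability" "HOL-Computational_Algebra.Polynomial"
begin

text \<open>The semicircle law on \<open>[-1, 1]\<close>; \<open>max 0\<close> is the positive part \<open>(1 - x\<^sup>2)\<^sub>+\<close>.\<close>

definition semicircle :: "real measure" where
  "semicircle = density lborel (\<lambda>x. ennreal (2 / pi * sqrt (max 0 (1 - x\<^sup>2))))"

text \<open>
  The trigonometric identity is only required where \<open>sin \<theta> \<noteq> 0\<close>.  The lemmas
  \<open>chebyshev_U_unique_exists\<close> and \<open>chebyshev_U_cos\<close> below show that the description is proper.
\<close>

definition chebyshev_U :: "nat \<Rightarrow> real poly" where
  "chebyshev_U n =
     (THE p. \<forall>\<theta>. sin \<theta> \<noteq> 0 \<longrightarrow> poly p (cos \<theta>) = sin (real (n + 1) * \<theta>) / sin \<theta>)"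

definition edge_rho :: "real \<Rightarrow> nat \<Rightarrow> real" where
  "edge_rho x n = max (1 - \<bar>x\<bar>) (1 / (real n)\<^sup>2)"

lemma chebyshev_U_unique_exists:
  "\<exists>!p. \<forall>\<theta>::real. sin \<theta> \<noteq> 0 \<longrightarrow> poly p (cos \<theta>) = sin (real (n + 1) * \<theta>) / sin \<theta>"
proof (rule ex_ex1I)
  let ?P = "\<lambda>n p. \<forall>\<theta>::real. sin \<theta> \<noteq> 0 \<longrightarrow> poly p (cos \<theta>) = sin (real (n + 1) * \<theta>) / sin \<theta>"
  have "\<exists>p q. ?P n p \<and> ?P (Suc n) q" for n
  proof (induction n)
    case 0
    have "?P 0 1" by simp
    moreover have "?P (Suc 0) [:0, 2:]" by (simp add: sin_double)
    ultimately show ?case by blast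
  next
    case (Suc n)
    then obtain p q where p: "?P n p" and q: "?P (Suc n) q" by blast
    have "?P (Suc (Suc n)) ([:0, 2:] * q - p)"
    proof (intro allI impI)
      fix t :: real
      assume t: "sin t \<noteq> 0"
      let ?s = "real (Suc n + 1) * t"
      have "sin (?s + t) + sin (?s - t) = 2 * cos t * sin ?s"
        by (simp add: sin_add sin_diff)
      moreover have "?s + t = real (Suc (Suc n) + 1) * t" "?s - t = real (n + 1) * t"
        by (simp_all add: algebra_simps)
      ultimately have "sin (real (Suc (Suc n) + 1) * t) = 2 * cos t * sin ?s - sin (real (n + 1) * t)"
        by simp
      then show "poly ([:0, 2:] * q - p) (cos t) = sin (real (Suc (Suc n) + 1) * t) / sin t"
        using p[rule_format, OF t] q[rule_format, OF t]
        by (simp add: diff_divide_distrib mult.assoc)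
    qed
    with q show ?case by blast
  qed
  then show "\<exists>p. ?P n p" by blast
next
  fix p q :: "real poly"
  assume p: "\<forall>\<theta>::real. sin \<theta> \<noteq> 0 \<longrightarrow> poly p (cos \<theta>) = sin (real (n + 1) * \<theta>) / sin \<theta>"
    and q: "\<forall>\<theta>::real. sin \<theta> \<noteq> 0 \<longrightarrow> poly q (cos \<theta>) = sin (real (n + 1) * \<theta>) / sin \<theta>"
  have "poly (p - q) x = 0" if "x \<in> {-1<..<1}" for x
  proof -
    have "sin (arccos x) \<noteq> 0" using that by (intro sin_arccos_nonzero) auto
    then show ?thesis using p[rule_format, of "arccos x"] q[rule_format, of "arccos x"] that
      by simp
  qed
  then have "{-1<..<1} \<subseteq> {x. poly (p - q) x = 0}" by blast
  moreover have "infinite {-1<..<(1::real)}" by (simp add: infinite_Ioo)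
  ultimately have "p - q = 0" using poly_roots_finite finite_subset by blast
  then show "p = q" by simp
qed

lemma chebyshev_U_cos:
  "sin \<theta> \<noteq> 0 \<Longrightarrow> poly (chebyshev_U n) (cos \<theta>) = sin (real (n + 1) * \<theta>) / sin \<theta>"
  using theI'[OF chebyshev_U_unique_exists[of n], folded chebyshev_U_def] by blast

end

theory Submission
  imports Defs
begin

text \<open>
  For a grid point \<open>c = (q + 1/2) \<pi> / m\<close> the Markov--Stieltjes construction gives a polynomial \<open>P\<close>
  of degree at most \<open>2 m - 2\<close> with \<open>P \<ge> 1\<close> on \<open>[cos c, \<infinity>)\<close> and \<open>P \<ge> 0\<close> on \<open>\<real>\<close>, equal to \<open>1\<close> at the zeros of
  the Chebyshev polynomial \<open>T\<^sub>m\<close> that lie in \<open>[cos c, \<infinity>)\<close> and to \<open>0\<close> at the other zeros.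
  Let \<open>E \<ge> 0\<close> be the excess of \<open>P(cos \<theta>)\<close> over the indicator of \<open>[0, c]\<close>.  Gauss quadrature at these
  zeros gives \<open>\<integral> E d\<theta> = \<pi> / (2 m)\<close> and \<open>\<integral> E sin\<^sup>2 \<theta> d\<theta> = O(sin\<^sup>2 c / m)\<close>.  The arithmetic-geometric
  mean inequality \<open>sin \<theta> \<le> s / 2 + sin\<^sup>2 \<theta> / (2 s)\<close> with \<open>s = sin c\<close> combines the two into
  \<open>\<integral> E sin \<theta> d\<theta> = O(s / m)\<close>, which bounds the coefficients of \<open>P\<close> in the basis \<open>U\<^sub>n\<close> by \<open>O(s / n)\<close>.
  Integrating \<open>P\<close> against \<open>\<mu>\<close> bounds \<open>\<mu>[x\<^sub>0, \<infinity>)\<close> from above; the lower bound follows by reflection.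
\<close>

section \<open>One-sided majorants\<close>

text \<open>The signs come from expanding \<open>1\<close> recursively with \<open>1 = (x - a) / (z - a) + (z - x) / (z - a)\<close>
  until one of the two products of linear factors has been split off.\<close>

lemma alternating_bezout:
  fixes z a :: "nat \<Rightarrow> real"
  assumes "\<And>i j. i < r \<Longrightarrow> j < s \<Longrightarrow> a j < z i"
  shows "\<exists>A B. A * (\<Prod>j<s. [:- a j, 1:]) + B * (\<Prod>i<r. [:z i, -1:]) = 1
    \<and> degree A \<le> r - 1 \<and> (r = 0 \<and> s > 0 \<longrightarrow> A = 0)
    \<and> (\<forall>x. (\<forall>i<r. x \<le> z i) \<longrightarrow> 0 \<le> poly A x)
    \<and> (\<forall>x. (\<forall>j<s. a j \<le> x) \<longrightarrow> 0 \<le> poly B x)"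
  using assms
proof (induction r arbitrary: s)
  case 0
  show ?case
  proof (cases "s = 0")
    case True
    then show ?thesis by (intro exI[of _ 1] exI[of _ 0]) auto
  next
    case False
    then show ?thesis by (intro exI[of _ 0] exI[of _ 1]) auto
  qed
next
  case (Suc r)
  note outer = Suc
  show ?case
    using outer(2)
  proof (induction s)
    case 0
    show ?case by (intro exI[of _ 1] exI[of _ 0]) auto
  next
    case (Suc s)
    let ?W = "\<Prod>j<s. [:- a j, 1:]" and ?V = "\<Prod>i<r. [:z i, -1:]"
    \<comment> \<open>The pair \<open>A1\<close>, \<open>B1\<close> omits the factor at
      \<open>a s\<close> (inner hypothesis), the pair \<open>A2\<close>, \<open>B2\<close> the
      factor at \<open>z r\<close> (outer hypothesis). The weights (x - a s) / d and (z r - x) / d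
      sum to 1 and restore the omitted factors.\<close>
    obtain A1 B1 where 1: "A1 * ?W + B1 * (?V * [:z r, -1:]) = 1" "degree A1 \<le> r"
      "\<And>x. (\<forall>i<Suc r. x \<le> z i) \<Longrightarrow> 0 \<le> poly A1 x"
      "\<And>x. (\<forall>j<s. a j \<le> x) \<Longrightarrow> 0 \<le> poly B1 x"
      using Suc.IH Suc.prems by (auto simp: less_Suc_eq)
    obtain A2 B2 where 2: "A2 * (?W * [:- a s, 1:]) + B2 * ?V = 1" "degree A2 \<le> r - 1"
      "r = 0 \<longrightarrow> A2 = 0"
      "\<And>x. (\<forall>i<r. x \<le> z i) \<Longrightarrow> 0 \<le> poly A2 x"
      "\<And>x. (\<forall>j<Suc s. a j \<le> x) \<Longrightarrow> 0 \<le> poly B2 x"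
      using outer(1)[of "Suc s"] Suc.prems by (auto simp: less_Suc_eq)
    define d where "d = z r - a s"
    have d: "d > 0" using Suc.prems[of r s] by (simp add: d_def)
    let ?A = "smult (1 / d) (A1 + [:z r, -1:] * A2)"
    let ?B = "smult (1 / d) ([:- a s, 1:] * B1 + B2)"
    have "smult (1 / d) ([:- a s, 1:] * (A1 * ?W + B1 * (?V * [:z r, -1:]))
        + [:z r, -1:] * (A2 * (?W * [:- a s, 1:]) + B2 * ?V)) = 1"
      unfolding 1(1) 2(1) using d by (simp add: d_def one_pCons)
    then have id: "?A * (\<Prod>j<Suc s. [:- a j, 1:]) + ?B * (\<Prod>i<Suc r. [:z i, -1:]) = 1"
      by (simp only: prod.lessThan_Suc mult_smult_left mult_smult_right smult_add_right[symmetric]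
          distrib_left distrib_right mult.assoc mult.left_commute mult.commute add.assoc
          add.left_commute add.commute)
    \<comment> \<open>For r = 0 the bound \<open>r - 1\<close> truncates to 0 and would only give
      degree 1 here; the clause \<open>A = 0\<close> of the induction claim covers this
      case.\<close>
    have "degree ([:z r, -1:] * A2) \<le> r"
    proof (cases "r = 0")
      case False
      have "degree ([:z r, -1:] * A2) \<le> 1 + (r - 1)"
        using degree_mult_le[of "[:z r, -1:]" A2] 2(2) by simp
      then show ?thesis using False by simp
    qed (use 2(3) in simp)
    then have deg: "degree ?A \<le> Suc r - 1"
      using 1(2) d by (simp add: degree_add_le)
    have sA: "0 \<le> poly ?A x" if "\<forall>i<Suc r. x \<le> z i" for x
    proof -
      have "0 \<le> poly A1 x" "0 \<le> poly A2 x" "0 \<le> z r - x" using that 1(3) 2(4) by auto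
      then have "0 \<le> (poly A1 x + (z r - x) * poly A2 x) / d" using d by simp
      then show ?thesis by (simp add: field_simps)
    qed
    have sB: "0 \<le> poly ?B x" if "\<forall>j<Suc s. a j \<le> x" for x
    proof -
      have "0 \<le> poly B1 x" "0 \<le> poly B2 x" "0 \<le> x - a s" using that 1(4) 2(5) by auto
      then have "0 \<le> ((x - a s) * poly B1 x + poly B2 x) / d" using d by simp
      then show ?thesis by (simp add: field_simps)
    qed
    show ?case using id deg sA sB by (intro exI[of _ ?A] exI[of _ ?B]) auto
  qed
qed

text \<open>Indexing by \<open>i div 2\<close> lists every node twice, so that
  \<open>alternating_bezout\<close> can be applied to double nodes.\<close>

lemma prod_div2:
  fixes f :: "nat \<Rightarrow> 'a::comm_monoid_mult"
  shows "(\<Prod>i<2 * n. f (i div 2)) = (\<Prod>i<n. f i ^ 2)"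
  by (induction n) (simp_all add: power2_eq_square mult.assoc)

text \<open>The polynomial is A * W = 1 - B * V, where W has double zeros at the nodes below
  \<open>y q\<close> and V vanishes at the remaining ones. Right of \<open>y q\<close>, B \<ge> 0
  and V \<le> 0 give the bound 1; left of it, A and W are both nonnegative. The degrees 2 q of A and
  2 (m - q - 1) of W add up to 2 m - 2.\<close>

lemma one_sided_polynomial:
  fixes y :: "nat \<Rightarrow> real"
  assumes dec: "\<And>i j. i < j \<Longrightarrow> j < m \<Longrightarrow> y j < y i" and q: "q < m"
  obtains P where "degree P \<le> 2 * m - 2" "\<And>x. 0 \<le> poly P x" "\<And>x. y q \<le> x \<Longrightarrow> 1 \<le> poly P x"
    "\<And>j. j \<le> q \<Longrightarrow> poly P (y j) = 1" "\<And>j. q < j \<Longrightarrow> j < m \<Longrightarrow> poly P (y j) = 0"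
proof -
  define n where "n = m - Suc q"
  define W where "W = (\<Prod>j<n. [:- y (Suc q + j), 1:] ^ 2)"
  define V where "V = (\<Prod>i<q. [:y i, -1:] ^ 2) * [:y q, -1:]"
  have W: "(\<Prod>j<2 * n. [:- y (Suc q + j div 2), 1:]) = W"
    unfolding W_def by (rule prod_div2)
  \<comment> \<open>The odd number of factors leaves \<open>y q\<close> as a simple zero of V, which
    is therefore the only place where V changes sign.\<close>
  have V: "(\<Prod>i<Suc (2 * q). [:y (i div 2), -1:]) = V"
    unfolding V_def prod.lessThan_Suc using prod_div2[of "\<lambda>i. [:y i, -1:]" q] by simp
  obtain A B where id: "A * W + B * V = 1" and deg: "degree A \<le> 2 * q"
    and A: "\<And>x. (\<forall>i<Suc (2 * q). x \<le> y (i div 2)) \<Longrightarrow> 0 \<le> poly A x"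
    and B: "\<And>x. (\<forall>j<2 * n. y (Suc q + j div 2) \<le> x) \<Longrightarrow> 0 \<le> poly B x"
  proof -
    have "y (Suc q + j div 2) < y (i div 2)" if "i < Suc (2 * q)" "j < 2 * n" for i j
      by (rule dec) (use that in \<open>auto simp: n_def\<close>)
    from alternating_bezout[of "Suc (2 * q)" "2 * n" "\<lambda>j. y (Suc q + j div 2)" "\<lambda>i. y (i div 2)",
        OF this, unfolded W V]
    show ?thesis using that by auto
  qed
  have dec': "y j \<le> y i" if "i \<le> j" "j < m" for i j
    using dec[of i j] that by (cases "i = j") auto
  have W0: "0 \<le> poly W x" for x
    by (simp add: W_def poly_prod prod_nonneg)
  have Vx: "poly V x = (\<Prod>i<q. (y i - x)\<^sup>2) * (y q - x)" for x
    by (simp add: V_def poly_prod algebra_simps)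
  have idx: "poly A x * poly W x + poly B x * poly V x = 1" for x
    using arg_cong[OF id, of "\<lambda>p. poly p x"] by simp
  have ge1: "1 \<le> poly (A * W) x" if "y q \<le> x" for x
  proof -
    have "0 \<le> poly B x"
    proof (intro B allI impI)
      fix j assume "j < 2 * n"
      then show "y (Suc q + j div 2) \<le> x"
        using dec'[of q "Suc q + j div 2"] that by (intro order.trans[OF _ that]) (auto simp: n_def)
    qed
    moreover have "poly V x \<le> 0"
      unfolding Vx using that by (intro mult_nonneg_nonpos prod_nonneg) auto
    ultimately have "poly B x * poly V x \<le> 0" by (rule mult_nonneg_nonpos)
    then show ?thesis using idx[of x] by simp
  qed
  show thesis
  proof
    have "degree W \<le> (\<Sum>j<n. 2)"
      unfolding W_def by (rule order.trans[OF degree_prod_sum_le])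
        (auto intro!: sum_mono simp: degree_power_eq)
    then show "degree (A * W) \<le> 2 * m - 2"
      using degree_mult_le[of A W] deg q by (simp add: n_def)
    show "0 \<le> poly (A * W) x" for x
    proof (cases "y q \<le> x")
      case False
      have "0 \<le> poly A x"
      proof (intro A allI impI)
        fix i assume "i < Suc (2 * q)"
        then have "y q \<le> y (i div 2)" using dec'[of "i div 2" q] q by auto
        then show "x \<le> y (i div 2)" using False by simp
      qed
      then show ?thesis using W0 by simp
    qed (use ge1 in force)
    show "1 \<le> poly (A * W) x" if "y q \<le> x" for x by (rule ge1[OF that])
    show "poly (A * W) (y j) = 1" if "j \<le> q" for j
    proof -
      have "poly V (y j) = 0" unfolding Vx using that by (cases "j = q") auto
      then show ?thesis using idx[of "y j"] by simp
    qed
    show "poly (A * W) (y j) = 0" if "q < j" "j < m" for j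
    proof -
      have "\<exists>i<n. y j = y (Suc q + i)" using that by (intro exI[of _ "j - Suc q"]) (auto simp: n_def)
      then have "poly W (y j) = 0" by (auto simp: W_def poly_prod)
      then show ?thesis by simp
    qed
  qed
qed

text \<open>Otherwise P would be negative for large arguments. This supplies the sign condition of
  \<open>quadrature_upper\<close>.\<close>

lemma coeff_top_nonneg:
  fixes P :: "real poly"
  assumes "degree P \<le> n" and "\<And>x. 0 \<le> poly P x"
  shows "0 \<le> coeff P n"
proof (rule ccontr)
  assume neg: "\<not> 0 \<le> coeff P n"
  then have "degree P = n" using assms(1) by (metis coeff_eq_0 le_neq_implies_less order_refl)
  then have "0 < lead_coeff (- P)" using neg by simp
  then obtain x where "0 < poly (- P) x"
    using poly_pinfty_gt_lc[of "- P"] by (meson less_le_trans order_refl)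
  then show False using assms(2)[of x] by simp
qed

section \<open>Quadrature at Chebyshev nodes\<close>

lemma has_integral_cos_multiple:
  fixes j :: nat
  assumes "j > 0"
  shows "((\<lambda>t. cos (real j * t)) has_integral 0) {0..pi}"
proof -
  have "((\<lambda>t. cos (real j * t)) has_integral sin (real j * pi) / real j - sin (real j * 0) / real j) {0..pi}"
    using assms
    by (intro fundamental_theorem_of_calculus)
      (auto intro!: derivative_eq_intros simp: has_real_derivative_iff_has_vector_derivative[symmetric])
  then show ?thesis by simp
qed

text \<open>Telescoping: multiplied by 2 sin(x / 2), each cosine becomes a difference of consecutive
  values sin(k x).\<close>

lemma sum_cos_midpoints:
  "2 * sin (x / 2) * (\<Sum>j<k. cos ((real j + 1/2) * x)) = sin (real k * x)"
proof (induction k)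
  case (Suc k)
  have "2 * sin (x / 2) * cos ((real k + 1/2) * x) = sin (real (Suc k) * x) - sin (real k * x)"
    using sin_diff_sin[of "real (Suc k) * x" "real k * x"]
    by (simp add: algebra_simps add_divide_distrib)
  then show ?case using Suc by (simp add: algebra_simps)
qed simp

text \<open>For 0 < j < 2 m both sides vanish: the closed form of the node sum has numerator sin(j
  \<pi>) = 0, and its denominator is nonzero because j \<pi> / (2 m) lies strictly between 0 and
  \<pi>.\<close>

lemma quadrature_cos:
  assumes "j < 2 * m"
  shows "((\<lambda>t. cos (real j * t)) has_integral
      pi / real m * (\<Sum>i<m. cos (real j * ((real i + 1/2) * (pi / real m))))) {0..pi}"
proof (cases "j = 0")
  case True
  then show ?thesis using has_integral_const_real[of "1::real" 0 pi] assms by (simp del: has_integral_const_real)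
next
  case False
  let ?x = "real j * (pi / real m)"
  have "0 < ?x / 2" "?x / 2 < pi" using False assms by (auto simp: field_simps)
  then have "sin (?x / 2) > 0" by (rule sin_gt_zero)
  moreover have "real m * ?x = real j * pi" using assms by auto
  ultimately have "(\<Sum>i<m. cos ((real i + 1/2) * ?x)) = 0"
    using sum_cos_midpoints[of ?x m] by simp
  then have "(\<Sum>i<m. cos (real j * ((real i + 1/2) * (pi / real m)))) = 0"
    by (simp only: mult.left_commute)
  then show ?thesis using has_integral_cos_multiple[of j] False by simp
qed

text \<open>The product formula for cos t cos(j t) trades one power of cos t for a shift of the
  frequency by one in either direction, and n + j does not grow under this exchange.\<close>

lemma quadrature_cos_power:
  assumes "n + j < 2 * m"
  shows "((\<lambda>t. cos t ^ n * cos (real j * t)) has_integral pi / real m *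
      (\<Sum>i<m. cos ((real i + 1/2) * (pi / real m)) ^ n * cos (real j * ((real i + 1/2) * (pi / real m))))) {0..pi}"
  using assms
proof (induction n arbitrary: j)
  case 0
  then show ?case using quadrature_cos[of j m] by simp
next
  case (Suc n)
  let ?t = "\<lambda>i. (real i + 1/2) * (pi / real m)"
  show ?case
  proof (cases j)
    case 0
    then show ?thesis using Suc.IH[of 1] Suc.prems by (simp add: mult.commute)
  next
    case (Suc l)
    have split: "cos t ^ Suc n * cos (real j * t) =
        (cos t ^ n * cos (real (Suc j) * t) + cos t ^ n * cos (real l * t)) / 2" for t
    proof -
      have "cos t * cos (real j * t) = (cos (real (Suc j) * t) + cos (real l * t)) / 2"
        using cos_times_cos[of "real j * t" t] by (simp add: Suc algebra_simps)
      then show ?thesis by (simp only: power_Suc2 mult.assoc) (simp add: algebra_simps)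
    qed
    have "((\<lambda>t. (cos t ^ n * cos (real (Suc j) * t) + cos t ^ n * cos (real l * t)) / 2) has_integral
        (pi / real m * (\<Sum>i<m. cos (?t i) ^ n * cos (real (Suc j) * ?t i))
         + pi / real m * (\<Sum>i<m. cos (?t i) ^ n * cos (real l * ?t i))) / 2) {0..pi}"
      by (intro has_integral_divide has_integral_add Suc.IH) (use Suc.prems Suc in auto)
    then show ?thesis
      unfolding split by (simp only: sum_divide_distrib[symmetric] sum.distrib distrib_left
          times_divide_eq_right)
  qed
qed

lemma quadrature_poly:
  fixes f :: "real poly"
  assumes "degree f < 2 * m"
  shows "((\<lambda>t. poly f (cos t)) has_integral
      pi / real m * (\<Sum>i<m. poly f (cos ((real i + 1/2) * (pi / real m))))) {0..pi}"
proof -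
  let ?t = "\<lambda>i. (real i + 1/2) * (pi / real m)"
  have "((\<lambda>t. \<Sum>n\<le>degree f. coeff f n * (cos t ^ n * cos (real 0 * t))) has_integral
      (\<Sum>n\<le>degree f. coeff f n * (pi / real m * (\<Sum>i<m. cos (?t i) ^ n * cos (real 0 * ?t i))))) {0..pi}"
    by (intro has_integral_sum has_integral_mult_right quadrature_cos_power) (use assms in auto)
  moreover have "(\<Sum>n\<le>degree f. coeff f n * (pi / real m * (\<Sum>i<m. cos (?t i) ^ n * cos (real 0 * ?t i))))
      = pi / real m * (\<Sum>i<m. poly f (cos (?t i)))"
    by (simp add: poly_altdef sum_distrib_left sum.swap[of _ "{..<m}"] algebra_simps)
  ultimately show ?thesis by (simp add: poly_altdef)
qed

text \<open>At degree \<open>2 * m\<close> the quadrature rule is off by a multiple of the integral of the squared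
  node polynomial, which has the sign of the top coefficient.\<close>

lemma quadrature_upper:
  fixes P :: "real poly"
  assumes deg: "degree P \<le> 2 * m - 2" and lc: "0 \<le> coeff P (2 * m - 2)" and m: "m > 0"
  shows "integral {0..pi} (\<lambda>t. poly P (cos t) * (sin t)\<^sup>2)
    \<le> pi / real m * (\<Sum>i<m. poly P (cos ((real i + 1/2) * (pi / real m)))
        * (sin ((real i + 1/2) * (pi / real m)))\<^sup>2)"
proof -
  let ?t = "\<lambda>i. (real i + 1/2) * (pi / real m)"
  define c where "c = coeff P (2 * m - 2)"
  define N where "N = (\<Prod>i<m. [:- cos (?t i), 1:])"
  define f where "f = [:1, 0, -1:] * P"
  \<comment> \<open>The coefficient of \<open>f\<close> at 2 m is -c, so the added square brings the
    degree below 2 m, where the rule is exact. It vanishes at the nodes and is nonnegative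
    elsewhere, since c \<ge> 0.\<close>
  define g where "g = f + smult c (N\<^sup>2)"
  have N: "degree N = m" "lead_coeff N = 1"
    unfolding N_def by (subst degree_prod_eq_sum_degree) (auto simp: lead_coeff_prod)
  have N2: "degree (N\<^sup>2) = 2 * m" "coeff (N\<^sup>2) (2 * m) = 1"
  proof -
    have "N \<noteq> 0" using N(2) by auto
    then show "degree (N\<^sup>2) = 2 * m" using N(1) by (simp add: degree_power_eq)
    show "coeff (N\<^sup>2) (2 * m) = 1"
      using coeff_mult_degree_sum[of N N] N by (simp add: power2_eq_square mult_2)
  qed
  have "degree g \<le> 2 * m"
  proof -
    have "degree f \<le> 2 + (2 * m - 2)"
      using degree_mult_le[of "[:1, 0, -1:]" P] deg by (simp add: f_def)
    then have "degree f \<le> 2 * m" using m by simp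
    then show ?thesis unfolding g_def using N2(1) degree_smult_le[of c "N\<^sup>2"]
      by (intro degree_add_le) auto
  qed
  moreover have "coeff g (2 * m) = 0"
  proof -
    have "coeff f (2 * m) = - c"
    proof -
      obtain l where l: "2 * m = Suc (Suc l)" using m by (metis Suc_pred mult_2 add_Suc_right add_Suc add_gr_0)
      have "coeff P (2 * m) = 0" using deg l by (intro coeff_eq_0) auto
      then show ?thesis using l by (simp add: f_def c_def)
    qed
    then show ?thesis by (simp add: g_def N2)
  qed
  ultimately have "degree g < 2 * m"
    using m by (metis degree_0 eq_zero_or_degree_less less_le_trans mult_pos_pos zero_less_numeral)
  note quad = quadrature_poly[OF this]
  have f: "poly f (cos t) = poly P (cos t) * (sin t)\<^sup>2" for t
    by (simp only: sin_squared_eq) (simp add: f_def power2_eq_square algebra_simps)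
  have "poly N (cos (?t i)) = 0" if "i < m" for i
    using that by (auto simp: N_def poly_prod)
  then have node: "poly g (cos (?t i)) = poly P (cos (?t i)) * (sin (?t i))\<^sup>2" if "i < m" for i
    using that by (simp add: g_def f)
  have "integral {0..pi} (\<lambda>t. poly P (cos t) * (sin t)\<^sup>2) \<le> integral {0..pi} (\<lambda>t. poly g (cos t))"
    using lc by (intro integral_le integrable_continuous_real continuous_intros)
      (auto simp: g_def f c_def)
  also have "\<dots> = pi / real m * (\<Sum>i<m. poly g (cos (?t i)))"
    using quad by (rule integral_unique)
  also have "(\<Sum>i<m. poly g (cos (?t i))) = (\<Sum>i<m. poly P (cos (?t i)) * (sin (?t i))\<^sup>2)"
    by (intro sum.cong refl node) simp
  finally show ?thesis .
qed

section \<open>Trigonometric estimates and the semicircle law\<close>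

lemma abs_sin_add_le: "\<bar>sin (x + y)\<bar> \<le> \<bar>sin x\<bar> + \<bar>sin y\<bar>" for x y :: real
proof -
  have "\<bar>sin (x + y)\<bar> \<le> \<bar>sin x\<bar> * \<bar>cos y\<bar> + \<bar>cos x\<bar> * \<bar>sin y\<bar>"
    unfolding sin_add by (metis abs_mult abs_triangle_ineq)
  also have "\<dots> \<le> \<bar>sin x\<bar> * 1 + 1 * \<bar>sin y\<bar>"
    by (intro add_mono mult_mono) auto
  finally show ?thesis by simp
qed

lemma abs_sin_mult_le: "\<bar>sin (real n * x)\<bar> \<le> real n * \<bar>sin x\<bar>" for x :: real
proof (induction n)
  case (Suc n)
  then show ?case using abs_sin_add_le[of "real n * x" x] by (simp add: algebra_simps)
qed simp

lemma mult_cos_le_sin: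
  fixes x :: real
  assumes "0 \<le> x" "x \<le> pi"
  shows "x * cos x \<le> sin x"
proof -
  have "sin 0 - 0 * cos 0 \<le> sin x - x * cos x"
  proof (rule DERIV_nonneg_imp_nondecreasing[OF assms(1)])
    fix y assume y: "0 \<le> y" "y \<le> x"
    have "((\<lambda>x. sin x - x * cos x) has_real_derivative y * sin y) (at y)"
      by (auto intro!: derivative_eq_intros)
    moreover have "0 \<le> y * sin y" using y assms by (simp add: sin_ge_zero)
    ultimately show "\<exists>z. ((\<lambda>x. sin x - x * cos x) has_real_derivative z) (at y) \<and> 0 \<le> z" by blast
  qed
  then show ?thesis by simp
qed

text \<open>A weak form of Jordan's inequality: cos x \<ge> 0 gives 2 cos^2(x / 2) \<ge> 1, and
  \<open>mult_cos_le_sin\<close> at x / 2 leads to the double angle formula.\<close>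

lemma half_le_sin:
  fixes x :: real
  assumes "0 \<le> x" "x \<le> pi / 2"
  shows "x / 2 \<le> sin x"
proof -
  have c: "0 \<le> cos (x / 2)" "0 \<le> cos x" using assms by (auto intro!: cos_ge_zero)
  have "x / 2 \<le> x * (cos (x / 2))\<^sup>2"
    using mult_left_mono[of 1 "2 * (cos (x / 2))\<^sup>2" x] c assms cos_double_cos[of "x / 2"] by simp
  also have "\<dots> \<le> 2 * sin (x / 2) * cos (x / 2)"
    using mult_right_mono[OF mult_cos_le_sin[of "x / 2"] c(1)] assms
    by (simp add: power2_eq_square)
  also have "\<dots> = sin x" using sin_double[of "x / 2"] by simp
  finally show ?thesis .
qed

text \<open>Chains x - sin x \<le> x (1 - cos x), 1 - cos x \<le> x^2 / 2 and x / 2 \<le> sin x. It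
  serves to bound h / sin h - 1 by h^2.\<close>

lemma minus_sin_le:
  fixes x :: real
  assumes "0 \<le> x" "x \<le> pi / 2"
  shows "x - sin x \<le> x\<^sup>2 * sin x"
proof -
  have "(sin (x / 2))\<^sup>2 \<le> (x / 2)\<^sup>2"
    using sin_x_le_x[of "x / 2"] assms by (intro power_mono sin_ge_zero) auto
  then have "1 - cos x \<le> x\<^sup>2 / 2"
    using cos_double_sin[of "x / 2"] by (simp add: power2_eq_square)
  then have "x * (1 - cos x) \<le> x * (x\<^sup>2 / 2)" using assms by (intro mult_left_mono) auto
  also have "\<dots> = x\<^sup>2 * (x / 2)" by simp
  also have "\<dots> \<le> x\<^sup>2 * sin x" using half_le_sin[OF assms] by (intro mult_left_mono) auto
  finally show ?thesis using mult_cos_le_sin[of x] assms by (simp add: algebra_simps)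
qed

text \<open>For 0 \<le> t \<le> \<pi> this is the semicircle mass of [cos t, \<infinity>): under x =
  cos t the density becomes (2 / \<pi>) sin^2 t.\<close>

definition semicircle_tail :: "real \<Rightarrow> real" where
  "semicircle_tail t = (t - sin t * cos t) / pi"

lemma DERIV_semicircle_tail:
  "(semicircle_tail has_real_derivative 2 / pi * (sin t)\<^sup>2) (at t within S)"
proof -
  have "1 - (cos t * cos t - sin t * sin t) = 2 * (sin t)\<^sup>2"
    using sin_cos_squared_add[of t] by (simp add: power2_eq_square)
  then show ?thesis
    unfolding semicircle_tail_def by (auto intro!: derivative_eq_intros)
qed

lemma has_integral_sin_squared:
  assumes "0 \<le> c"
  shows "((\<lambda>t. (sin t)\<^sup>2) has_integral pi / 2 * semicircle_tail c) {0..c}"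
proof -
  have "((\<lambda>t. 2 / pi * (sin t)\<^sup>2) has_integral semicircle_tail c - semicircle_tail 0) {0..c}"
    using assms DERIV_semicircle_tail
    by (intro fundamental_theorem_of_calculus)
      (auto simp: has_real_derivative_iff_has_vector_derivative[symmetric])
  from has_integral_mult_right[OF this, of "pi / 2"] show ?thesis
    by (simp add: semicircle_tail_def)
qed

lemma semicircle_tail_diff_le:
  assumes "a \<le> b" and "\<And>t. a \<le> t \<Longrightarrow> t \<le> b \<Longrightarrow> \<bar>sin t\<bar> \<le> B"
  shows "semicircle_tail b - semicircle_tail a \<le> 2 / pi * ((b - a) * B\<^sup>2)"
proof (cases "a = b")
  case False
  then have "a < b" using assms by simp
  from MVT2[OF this, of semicircle_tail "\<lambda>t. 2 / pi * (sin t)\<^sup>2"] DERIV_semicircle_tail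
  obtain z where z: "a < z" "z < b"
    "semicircle_tail b - semicircle_tail a = (b - a) * (2 / pi * (sin z)\<^sup>2)" by blast
  have "(sin z)\<^sup>2 \<le> B\<^sup>2" using power_mono[OF assms(2)[of z], of 2] z by simp
  then have "(b - a) * (sin z)\<^sup>2 \<le> (b - a) * B\<^sup>2" using assms(1) by (intro mult_left_mono) auto
  from mult_left_mono[OF this, of "2 / pi"] show ?thesis
    unfolding z(3) by (simp only: mult.left_commute) simp
qed simp

lemma midpoint_sum_sin_squared:
  "4 * sin x * (\<Sum>j<k. (sin ((real j + 1/2) * x))\<^sup>2) = 2 * real k * sin x - sin (2 * (real k * x))"
proof (induction k)
  case (Suc k)
  let ?u = "(real k + 1/2) * x"
  have "sin (2 * real (Suc k) * x) - sin (2 * real k * x) = 2 * sin x * cos (2 * ?u)"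
    using sin_diff_sin[of "2 * real (Suc k) * x" "2 * real k * x"]
    by (simp add: algebra_simps add_divide_distrib)
  moreover have "4 * sin x * (sin ?u)\<^sup>2 = 2 * sin x - 2 * sin x * cos (2 * ?u)"
    unfolding cos_double_sin by (simp add: algebra_simps)
  ultimately show ?case using Suc by (simp add: algebra_simps)
qed simp

text \<open>By the closed form, the sum differs from the integral over [0, (q + 1) h] by a multiple
  of h / sin h - 1, which costs 4 h sin^2 c. As (q + 1) h = c + h / 2, moving the endpoint back to c
  costs another 2 h sin^2 c.\<close>

lemma midpoint_sum_upper:
  fixes m q :: nat
  defines "h \<equiv> pi / real m"
  defines "c \<equiv> (real q + 1/2) * h"
  assumes m: "2 \<le> m" and q: "q < m"
  shows "h * (\<Sum>j<Suc q. (sin ((real j + 1/2) * h))\<^sup>2)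
    \<le> pi / 2 * semicircle_tail c + 6 * h * (sin c)\<^sup>2"
proof -
  define s where "s = sin c"
  have h: "0 < h" "h \<le> pi / 2" using m by (auto simp: h_def field_simps)
  have hm: "real m * h = pi" using m by (simp add: h_def)
  have c: "h / 2 \<le> c" "c \<le> pi - h / 2"
  proof -
    have "real q \<le> real m - 1" using q by simp
    then have "(real q + 1/2) * h \<le> (real m - 1/2) * h" using h by (intro mult_right_mono) auto
    then show "c \<le> pi - h / 2" using hm by (simp add: c_def algebra_simps)
    show "h / 2 \<le> c" using h by (simp add: c_def algebra_simps)
  qed
  have sh: "0 < sin (h / 2)" "0 < sin h" using h by (auto intro!: sin_gt_zero)
  \<comment> \<open>Grid angles keep distance h / 2 from 0 and \<pi>, so h = O(s) even at the edge;
    this is what makes errors in h expressible through s.\<close>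
  have s_ge: "sin (h / 2) \<le> s"
  proof (cases "c \<le> pi / 2")
    case True
    then show ?thesis unfolding s_def using c h by (intro sin_monotone_2pi_le) auto
  next
    case False
    have "sin (h / 2) \<le> sin (pi - c)" using c h False by (intro sin_monotone_2pi_le) auto
    then show ?thesis by (simp add: s_def)
  qed
  have h4: "h \<le> 4 * s" using half_le_sin[of "h / 2"] h s_ge by simp
  have s0: "0 < s" using s_ge sh by simp
  let ?k = "real (Suc q)"
  have sk: "\<bar>sin t\<bar> \<le> 2 * s" if "c \<le> t" "t \<le> c + h / 2" for t
  proof -
    have "\<bar>sin (t - c)\<bar> \<le> sin (h / 2)"
      using that h by (simp add: sin_ge_zero) (intro sin_monotone_2pi_le; simp)
    then show ?thesis using abs_sin_add_le[of c "t - c"] s_ge s0 by (simp add: s_def)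
  qed
  have kh: "?k * h = c + h / 2" by (simp add: c_def algebra_simps)
  have sum: "h * (\<Sum>j<Suc q. (sin ((real j + 1/2) * h))\<^sup>2)
      = ?k * h / 2 - h * sin (2 * (?k * h)) / (4 * sin h)"
  proof -
    have "h * S = k * h / 2 - h * z / (4 * w)" if "4 * w * S = 2 * k * w - z" "0 < w" for S k z w :: real
    proof -
      have "S = k / 2 - z / (4 * w)" using that by (simp add: field_simps)
      then show ?thesis by (simp add: right_diff_distrib)
    qed
    from this[OF midpoint_sum_sin_squared sh(2)] show ?thesis .
  qed
  have tail: "pi / 2 * semicircle_tail t = t / 2 - sin (2 * t) / 4" for t
    by (simp add: semicircle_tail_def sin_double)
  have "\<bar>sin (2 * (?k * h))\<bar> \<le> 2 * \<bar>sin (?k * h)\<bar>" using abs_sin_mult_le[of 2 "?k * h"] by simp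
  also have "\<dots> \<le> 4 * s" unfolding kh using sk[of "c + h / 2"] h by simp
  finally have s2: "\<bar>sin (2 * (?k * h))\<bar> \<le> 4 * s" .
  have "h * (\<Sum>j<Suc q. (sin ((real j + 1/2) * h))\<^sup>2) - pi / 2 * semicircle_tail (?k * h)
      = - sin (2 * (?k * h)) / 4 * ((h - sin h) / sin h)"
  proof -
    have "a - h * z / (4 * w) - (a - z / 4) = - z / 4 * ((h - w) / w)" if "0 < w" for a z w :: real
      using that by (simp add: diff_divide_distrib right_diff_distrib)
    from this[OF sh(2)] show ?thesis unfolding sum tail .
  qed
  also have "\<dots> \<le> \<bar>sin (2 * (?k * h)) / 4\<bar> * \<bar>(h - sin h) / sin h\<bar>"
    using abs_ge_minus_self[of "sin (2 * (?k * h)) / 4 * ((h - sin h) / sin h)"]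
    unfolding abs_mult by simp
  also have "\<dots> \<le> s * h\<^sup>2"
  proof (intro mult_mono)
    have "0 \<le> h - sin h" using sin_x_le_x[of h] h by simp
    then show "\<bar>(h - sin h) / sin h\<bar> \<le> h\<^sup>2"
      using minus_sin_le[of h] h sh by (simp add: divide_le_eq)
  qed (use s2 s0 in auto)
  also have "\<dots> \<le> 4 * h * s\<^sup>2"
    using mult_left_mono[OF h4, of "s * h"] s0 h by (simp add: power2_eq_square mult_ac)
  finally have 1: "h * (\<Sum>j<Suc q. (sin ((real j + 1/2) * h))\<^sup>2)
    \<le> pi / 2 * semicircle_tail (?k * h) + 4 * h * s\<^sup>2" by simp
  have "semicircle_tail (?k * h) - semicircle_tail c \<le> 2 / pi * ((?k * h - c) * (2 * s)\<^sup>2)"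
    by (rule semicircle_tail_diff_le) (use kh h sk in auto)
  then have "pi / 2 * (semicircle_tail (?k * h) - semicircle_tail c)
      \<le> pi / 2 * (2 / pi * ((?k * h - c) * (2 * s)\<^sup>2))"
    by (intro mult_left_mono) auto
  also have "\<dots> = 2 * h * s\<^sup>2" unfolding kh by (simp add: power2_eq_square)
  finally have "pi / 2 * semicircle_tail (?k * h) \<le> pi / 2 * semicircle_tail c + 2 * h * s\<^sup>2"
    by (simp add: algebra_simps)
  with 1 show ?thesis by (simp add: s_def)
qed

section \<open>Tail masses of the semicircle law\<close>

lemma semicircle_tail_nonneg:
  assumes "0 \<le> t" "t \<le> pi"
  shows "0 \<le> semicircle_tail t"
proof -
  have "sin t * cos t \<le> sin t * 1"
    using sin_ge_zero[OF assms] by (intro mult_left_mono) auto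
  also have "\<dots> \<le> t" using sin_x_le_x[OF assms(1)] by simp
  finally show ?thesis by (simp add: semicircle_tail_def)
qed

text \<open>Points right of [-1, 1] get angle 0 and points left of it angle \<pi>, so one tail
  formula serves all real x.\<close>

definition clamp_arccos :: "real \<Rightarrow> real" where
  "clamp_arccos x = arccos (max (- 1) (min 1 x))"

lemma clamp_arccos_bounds: "0 \<le> clamp_arccos x" "clamp_arccos x \<le> pi"
  by (auto simp: clamp_arccos_def intro!: arccos_lbound arccos_ubound)

lemma cos_clamp_arccos: "cos (clamp_arccos x) = max (- 1) (min 1 x)"
  by (simp add: clamp_arccos_def)

lemma clamp_arccos_minus: "clamp_arccos (- x) = pi - clamp_arccos x"
proof -
  have "max (- 1) (min 1 (- x)) = - max (- 1) (min 1 x)" by (simp add: max_def min_def)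
  then show ?thesis by (simp add: clamp_arccos_def arccos_minus)
qed

text \<open>Inside (-1, 1) the function \<open>F\<close> is a primitive of the density, by the
  substitution t = arccos x; at the endpoints only its continuity is used.\<close>

lemma measure_semicircle: "measure semicircle {x..} = semicircle_tail (clamp_arccos x)"
proof -
  define \<theta> where "\<theta> = clamp_arccos x"
  define f where "f t = 2 / pi * sqrt (max 0 (1 - t\<^sup>2))" for t :: real
  define F where "F t = - semicircle_tail (arccos t)" for t
  have \<theta>: "0 \<le> \<theta>" "\<theta> \<le> pi" by (simp_all add: \<theta>_def clamp_arccos_bounds)
  have "(f has_integral F 1 - F (cos \<theta>)) {cos \<theta>..1}"
  proof (rule fundamental_theorem_of_calculus_interior)
    show "continuous_on {cos \<theta>..1} F"
      unfolding F_def semicircle_tail_def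
      by (intro continuous_intros) (auto intro: order.trans[OF cos_ge_minus_one[of \<theta>]])
    fix t assume "t \<in> {cos \<theta><..<1}"
    then have t: "-1 < t" "t < 1" using cos_ge_minus_one[of \<theta>] by (auto simp del: cos_ge_minus_one)
    define w where "w = sqrt (1 - t\<^sup>2)"
    have "t\<^sup>2 < 1" using t by (simp add: abs_square_less_1)
    then have w: "0 < w" "f t = 2 / pi * w" by (simp_all add: w_def f_def)
    have "sin (arccos t) = w" using t by (simp add: sin_arccos w_def)
    then have "- (2 / pi * (sin (arccos t))\<^sup>2 * inverse (- w)) = f t"
      using w by (simp add: power2_eq_square)
    moreover have "(F has_real_derivative
        - (2 / pi * (sin (arccos t))\<^sup>2 * inverse (- sqrt (1 - t\<^sup>2)))) (at t)"
      unfolding F_def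
      by (intro DERIV_minus DERIV_chain2[OF DERIV_semicircle_tail] DERIV_arccos t)
    ultimately have "(F has_real_derivative f t) (at t)" by (simp add: w_def)
    then show "(F has_vector_derivative f t) (at t)"
      by (simp add: has_real_derivative_iff_has_vector_derivative)
  qed simp
  moreover have "F 1 - F (cos \<theta>) = semicircle_tail \<theta>"
    using \<theta> by (simp add: F_def arccos_cos semicircle_tail_def)
  ultimately have "(f has_integral semicircle_tail \<theta>) {cos \<theta>..1}" by simp
  moreover have "0 \<le> f t" for t by (simp add: f_def)
  ultimately have int: "(\<integral>\<^sup>+ t. ennreal (indicator {cos \<theta>..1} t * f t) \<partial>lborel) = ennreal (semicircle_tail \<theta>)"
    by (intro nn_integral_has_integral_lebesgue) auto
  \<comment> \<open>The two sets can differ only where |t| \<ge> 1, and there the positive part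
    makes the density zero.\<close>
  have eq: "ennreal (f t) * indicator {x..} t = ennreal (indicator {cos \<theta>..1} t * f t)" for t
  proof (cases "1 \<le> \<bar>t\<bar>")
    case True
    then have "1 \<le> t\<^sup>2" using abs_square_less_1[of t] by linarith
    then show ?thesis by (simp add: f_def)
  next
    case False
    then have "t \<in> {cos \<theta>..1} \<longleftrightarrow> t \<in> {x..}" by (auto simp: \<theta>_def cos_clamp_arccos)
    then show ?thesis by (simp add: indicator_def)
  qed
  have "emeasure semicircle {x..} = (\<integral>\<^sup>+ t. ennreal (f t) * indicator {x..} t \<partial>lborel)"
    unfolding semicircle_def f_def[symmetric] by (rule emeasure_density) (auto simp: f_def)
  also have "\<dots> = ennreal (semicircle_tail \<theta>)" unfolding eq int ..
  finally show ?thesis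
    using semicircle_tail_nonneg[OF \<theta>] by (simp add: measure_def \<theta>_def)
qed

lemma measure_semicircle_minus: "measure semicircle {- x..} = 1 - measure semicircle {x..}"
  by (simp add: measure_semicircle clamp_arccos_minus semicircle_tail_def diff_divide_distrib add_divide_distrib)

section \<open>Chebyshev expansions\<close>

lemma chebyshev_U_eqI:
  assumes "\<And>t. sin t \<noteq> 0 \<Longrightarrow> poly p (cos t) = sin (real (n + 1) * t) / sin t"
  shows "chebyshev_U n = p"
  unfolding chebyshev_U_def
  by (rule the1_equality[OF chebyshev_U_unique_exists]) (use assms in blast)

lemma chebyshev_U_0: "chebyshev_U 0 = 1"
  by (rule chebyshev_U_eqI) simp

lemma chebyshev_U_1: "chebyshev_U (Suc 0) = [:0, 2:]"
  by (rule chebyshev_U_eqI) (simp add: sin_double)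

lemma chebyshev_U_Suc_Suc:
  "chebyshev_U (Suc (Suc n)) = [:0, 2:] * chebyshev_U (Suc n) - chebyshev_U n"
proof (rule chebyshev_U_eqI)
  fix t :: real
  assume t: "sin t \<noteq> 0"
  let ?s = "real (Suc n + 1) * t"
  have "sin (?s + t) + sin (?s - t) = 2 * cos t * sin ?s"
    by (simp add: sin_add sin_diff)
  moreover have "?s + t = real (Suc (Suc n) + 1) * t" "?s - t = real (n + 1) * t"
    by (simp_all add: algebra_simps)
  ultimately have "sin (real (Suc (Suc n) + 1) * t) = 2 * cos t * sin ?s - sin (real (n + 1) * t)"
    by simp
  then show "poly ([:0, 2:] * chebyshev_U (Suc n) - chebyshev_U n) (cos t)
      = sin (real (Suc (Suc n) + 1) * t) / sin t"
    using chebyshev_U_cos[OF t, of "Suc n"] chebyshev_U_cos[OF t, of n]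
    by (simp add: diff_divide_distrib mult.assoc)
qed

text \<open>Clearing the denominator removes the exceptional angles: if sin t = 0, then |sin((n + 1)
  t)| \<le> (n + 1) |sin t| = 0.\<close>

lemma chebyshev_U_cos_mult_sin: "poly (chebyshev_U n) (cos t) * sin t = sin (real (n + 1) * t)"
proof (cases "sin t = 0")
  case True
  then show ?thesis using abs_sin_mult_le[of "n + 1" t] by simp
next
  case False
  then show ?thesis by (simp add: chebyshev_U_cos)
qed

lemma chebyshev_U_degree_coeff:
  "degree (chebyshev_U n) \<le> n \<and> coeff (chebyshev_U n) n = 2 ^ n"
proof (induction n rule: induct_nat_012)
  case (ge2 n)
  let ?U = "chebyshev_U"
  have "degree ([:0, 2:] * ?U (Suc n)) \<le> 1 + Suc n"
    using degree_mult_le[of "[:0, 2:]" "?U (Suc n)"] ge2 by simp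
  then have "degree (?U (Suc (Suc n))) \<le> Suc (Suc n)"
    unfolding chebyshev_U_Suc_Suc using ge2 by (intro degree_diff_le) auto
  moreover have "coeff (?U n) (Suc (Suc n)) = 0" using ge2 by (intro coeff_eq_0) auto
  ultimately show ?case using ge2 by (simp add: chebyshev_U_Suc_Suc)
qed (simp_all add: chebyshev_U_0 chebyshev_U_1)

lemma chebyshev_U_minus: "poly (chebyshev_U n) (- x) = (- 1) ^ n * poly (chebyshev_U n) x"
  by (induction n rule: induct_nat_012)
    (simp_all add: chebyshev_U_0 chebyshev_U_1 chebyshev_U_Suc_Suc algebra_simps)

lemma chebyshev_U_expansion:
  assumes "degree P \<le> N"
  shows "\<exists>p. P = (\<Sum>n\<le>N. smult (p n) (chebyshev_U n))"
  using assms
proof (induction N arbitrary: P)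
  case 0
  then show ?case
    by (intro exI[of _ "\<lambda>_. coeff P 0"]) (auto simp: chebyshev_U_0 elim!: degree_eq_zeroE)
next
  case (Suc N)
  define c where "c = coeff P (Suc N) / 2 ^ Suc N"
  let ?Q = "P - smult c (chebyshev_U (Suc N))"
  have U: "degree (chebyshev_U (Suc N)) \<le> Suc N" "coeff (chebyshev_U (Suc N)) (Suc N) = 2 ^ Suc N"
    using chebyshev_U_degree_coeff by blast+
  have "degree ?Q \<le> Suc N"
    using Suc.prems U(1) degree_smult_le[of c "chebyshev_U (Suc N)"] by (intro degree_diff_le) auto
  moreover have "coeff ?Q (Suc N) = 0" unfolding coeff_diff coeff_smult U(2) by (simp add: c_def)
  ultimately have "degree ?Q \<le> N"
    by (metis degree_0 eq_zero_or_degree_less le0 less_Suc_eq_le)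
  then obtain p where "?Q = (\<Sum>n\<le>N. smult (p n) (chebyshev_U n))" using Suc.IH by blast
  then have "P = (\<Sum>n\<le>N. smult (p n) (chebyshev_U n)) + smult c (chebyshev_U (Suc N))"
    by (simp add: algebra_simps)
  then show ?case by (intro exI[of _ "p(Suc N := c)"]) simp
qed

section \<open>Orthogonality and coefficients\<close>

lemma has_integral_sin_mult_sin:
  assumes "0 < a" "0 < b"
  shows "((\<lambda>t. sin (real a * t) * sin (real b * t)) has_integral (if a = b then pi / 2 else 0)) {0..pi}"
  using assms
proof (induction a b rule: linorder_wlog)
  case (sym a b)
  then show ?case by (simp add: mult.commute eq_commute)
next
  case (le a b)
  have id: "sin (real a * t) * sin (real b * t) = (cos (real (b - a) * t) - cos (real (a + b) * t)) / 2" for t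
    using sin_times_sin[of "real b * t" "real a * t"] le
    by (simp add: of_nat_diff algebra_simps)
  have "((\<lambda>t. cos (real (b - a) * t)) has_integral (if a = b then pi else 0)) {0..pi}"
    using has_integral_cos_multiple[of "b - a"] has_integral_const_real[of "1::real" 0 pi] le
    by (auto simp del: has_integral_const_real)
  moreover have "((\<lambda>t. cos (real (a + b) * t)) has_integral 0) {0..pi}"
    using le by (intro has_integral_cos_multiple) simp
  ultimately have "((\<lambda>t. (cos (real (b - a) * t) - cos (real (a + b) * t)) / 2) has_integral
      ((if a = b then pi else 0) - 0) / 2) {0..pi}"
    by (intro has_integral_divide has_integral_diff)
  then show ?case unfolding id by (auto split: if_splits)
qed

text \<open>One factor sin t of the weight sin^2 t turns U_k(cos t) into sin((k + 1) t), so
  orthogonality reduces to that of the sines.\<close>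

lemma chebyshev_U_coefficient:
  assumes P: "P = (\<Sum>n\<le>N. smult (p n) (chebyshev_U n))" and n: "n \<le> N"
  shows "((\<lambda>t. poly P (cos t) * (sin (real (n + 1) * t) * sin t)) has_integral pi / 2 * p n) {0..pi}"
proof -
  have "((\<lambda>t. \<Sum>k\<le>N. p k * (sin (real (k + 1) * t) * sin (real (n + 1) * t))) has_integral
      (\<Sum>k\<le>N. p k * (if k + 1 = n + 1 then pi / 2 else 0))) {0..pi}"
    by (intro has_integral_sum has_integral_mult_right has_integral_sin_mult_sin) auto
  moreover have "(\<Sum>k\<le>N. p k * (if k + 1 = n + 1 then pi / 2 else 0)) = pi / 2 * p n"
    using n by (simp add: if_distrib[of "(*) _"] cong: if_cong)
  moreover have "(\<Sum>k\<le>N. p k * (sin (real (k + 1) * t) * sin (real (n + 1) * t)))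
      = poly P (cos t) * (sin (real (n + 1) * t) * sin t)" for t
    unfolding P poly_sum poly_smult sum_distrib_right chebyshev_U_cos_mult_sin[symmetric]
    by (simp add: mult_ac)
  ultimately show ?thesis by (simp only:)
qed

section \<open>A majorant with controlled coefficients\<close>

text \<open>Up to the factor 2 / \<pi>, the integral is the n-th coefficient of the indicator of
  [cos c, \<infinity>). The gain over the plain bound O(1 / n) is the factor sin c.\<close>

lemma abs_integral_sin_mult_sin_le:
  fixes n :: nat
  assumes c: "0 \<le> c" and n: "0 < n"
  obtains J where "((\<lambda>t. sin (real (n + 1) * t) * sin t) has_integral J) {0..c}"
    "\<bar>J\<bar> \<le> 2 * \<bar>sin c\<bar> / real n"
proof -
  define G where "G t = (sin (real n * t) / real n - sin (real (n + 2) * t) / real (n + 2)) / 2" for t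
  have "((\<lambda>t. sin (real (n + 1) * t) * sin t) has_integral G c - G 0) {0..c}"
  proof (rule fundamental_theorem_of_calculus[OF c])
    fix t
    have "sin (real (n + 1) * t) * sin t = (cos (real n * t) - cos (real (n + 2) * t)) / 2"
      using sin_times_sin[of "real (n + 1) * t" t] by (simp add: algebra_simps)
    moreover have "(G has_real_derivative (cos (real n * t) - cos (real (n + 2) * t)) / 2) (at t within {0..c})"
      unfolding G_def using n by (auto intro!: derivative_eq_intros)
    ultimately show "(G has_vector_derivative sin (real (n + 1) * t) * sin t) (at t within {0..c})"
      by (simp only: has_real_derivative_iff_has_vector_derivative)
  qed
  moreover have "\<bar>G c - G 0\<bar> \<le> 2 * \<bar>sin c\<bar> / real n"
  proof -
    \<comment> \<open>Splitting off the common denominator n exposes sin c twice: the difference of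
      sines in \<open>?A\<close> contains it as a factor, and in \<open>?B\<close> it bounds sin((n
      + 2) c) / (n + 2).\<close>
    let ?A = "(sin (real n * c) - sin (real (n + 2) * c)) / real n"
    let ?B = "sin (real (n + 2) * c) / real (n + 2) * (2 / real n)"
    have "real n * c + real (n + 2) * c = 2 * (real (n + 1) * c)" by (simp add: algebra_simps)
    then have "sin (real n * c) - sin (real (n + 2) * c) = - (2 * sin c * cos (real (n + 1) * c))"
      using sin_diff_sin[of "real n * c" "real (n + 2) * c"] by (simp add: algebra_simps add_divide_distrib)
    then have "\<bar>?A\<bar> = 2 * \<bar>sin c\<bar> * \<bar>cos (real (n + 1) * c)\<bar> / real n" by (simp add: abs_mult)
    also have "\<dots> \<le> 2 * \<bar>sin c\<bar> * 1 / real n"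
      by (intro divide_right_mono mult_left_mono) auto
    finally have A: "\<bar>?A\<bar> \<le> 2 * \<bar>sin c\<bar> / real n" by simp
    have "\<bar>sin (real (n + 2) * c)\<bar> / real (n + 2) \<le> \<bar>sin c\<bar>"
      using abs_sin_mult_le[of "n + 2" c] by (simp add: divide_le_eq mult.commute)
    then have "\<bar>sin (real (n + 2) * c)\<bar> / real (n + 2) * (2 / real n) \<le> \<bar>sin c\<bar> * (2 / real n)"
      by (intro mult_right_mono) auto
    then have B: "\<bar>?B\<bar> \<le> 2 * \<bar>sin c\<bar> / real n" by (simp add: abs_mult mult_ac)
    have "1 / real n - 1 / real (n + 2) = 1 / real (n + 2) * (2 / real n)"
      using n by (simp add: field_simps)
    from arg_cong[OF this, of "(*) (sin (real (n + 2) * c))"]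
    have "?B = sin (real (n + 2) * c) / real n - sin (real (n + 2) * c) / real (n + 2)"
      by (simp add: right_diff_distrib)
    then have "G c - G 0 = (?A + ?B) / 2" by (simp add: G_def diff_divide_distrib)
    moreover have "\<bar>(a + b) / 2\<bar> \<le> d" if "\<bar>a\<bar> \<le> d" "\<bar>b\<bar> \<le> d" for a b d :: real
      using that by (auto simp: abs_le_iff)
    ultimately show ?thesis using A B by (simp only:)
  qed
  ultimately show thesis by (rule that)
qed

text \<open>For n > 0 the coefficient splits into that of the indicator of [0, c], bounded by
  \<open>abs_integral_sin_mult_sin_le\<close>, and an error at most (2 / \<pi>) \<integral> E sin t
  dt. For n = 0 the excess over the semicircle mass is exactly (2 / \<pi>) \<integral> E sin^2 t
  dt.\<close>

lemma one_sided_chebyshev_U: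
  fixes m q :: nat
  defines "h \<equiv> pi / real m"
  defines "c \<equiv> (real q + 1/2) * h"
  assumes m: "2 \<le> m" and q: "q < m"
  obtains P p where "P = (\<Sum>n\<le>2 * m - 2. smult (p n) (chebyshev_U n))"
    "\<And>x. 0 \<le> poly P x" "\<And>x. cos c \<le> x \<Longrightarrow> 1 \<le> poly P x"
    "p 0 \<le> semicircle_tail c + 4 * h * (sin c)\<^sup>2"
    "\<And>n. 0 < n \<Longrightarrow> n \<le> 2 * m - 2 \<Longrightarrow> \<bar>p n\<bar> \<le> 18 * sin c / real n"
proof -
  define y where "y j = (real j + 1/2) * h" for j :: nat
  have h: "0 < h" using m by (simp add: h_def)
  have hm: "real m * h = pi" using m by (simp add: h_def)
  have yc: "y q = c" by (simp add: y_def c_def)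
  have y0: "0 < y j" for j using h by (simp add: y_def)
  have ypi: "y j < pi" if "j < m" for j
  proof -
    have "real j + 1/2 < real m" using that by linarith
    then show ?thesis unfolding y_def using h by (simp flip: hm)
  qed
  have ymono: "y i < y j" if "i < j" for i j using that h by (simp add: y_def)
  have c: "0 < c" "c < pi" using y0[of q] ypi[OF q] yc by auto
  define s where "s = sin c"
  have s: "0 < s" unfolding s_def using c by (rule sin_gt_zero)
  obtain P where deg: "degree P \<le> 2 * m - 2" and P0: "\<And>x. 0 \<le> poly P x"
    and P1: "\<And>x. cos (y q) \<le> x \<Longrightarrow> 1 \<le> poly P x"
    and Pl: "\<And>j. j \<le> q \<Longrightarrow> poly P (cos (y j)) = 1"
    and Pr: "\<And>j. q < j \<Longrightarrow> j < m \<Longrightarrow> poly P (cos (y j)) = 0"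
  proof (rule one_sided_polynomial[OF _ q, of "\<lambda>j. cos (y j)"])
    fix i j assume "i < j" "j < m"
    then show "cos (y j) < cos (y i)"
      using ymono[of i j] y0[of i] ypi[of j] by (intro cos_monotone_0_pi) auto
  qed blast
  obtain p where p: "P = (\<Sum>n\<le>2 * m - 2. smult (p n) (chebyshev_U n))"
    using chebyshev_U_expansion[OF deg] by blast
  have node: "poly P (cos (y j)) = (if j < Suc q then 1 else 0)" if "j < m" for j
    using Pl[of j] Pr[of j] that by auto
  have sub: "{..<Suc q} \<subseteq> {..<m}" using q by auto
  define E where "E t = poly P (cos t) - (if t \<in> {0..c} then 1 else 0)" for t
  have E0: "0 \<le> E t" if "t \<in> {0..pi}" for t
  proof (cases "t \<le> c")
    case True
    then have "cos c \<le> cos t" using that c by (intro cos_monotone_0_pi_le) auto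
    then show ?thesis using P1 that yc True by (simp add: E_def)
  qed (simp add: E_def P0)
  have E_integral: "((\<lambda>t. E t * g t) has_integral I - J) {0..pi}"
    if "((\<lambda>t. poly P (cos t) * g t) has_integral I) {0..pi}" "(g has_integral J) {0..c}" for g I J
  proof -
    have "((\<lambda>t. if t \<in> {0..c} then g t else 0) has_integral J) {0..pi}"
      using that(2) c by (subst has_integral_restrict) auto
    from has_integral_diff[OF that(1) this] show ?thesis
      by (rule has_integral_eq[rotated]) (auto simp: E_def algebra_simps)
  qed
  have "((\<lambda>t. poly P (cos t)) has_integral pi / real m * (\<Sum>i<m. poly P (cos (y i)))) {0..pi}"
    unfolding y_def h_def using deg m by (intro quadrature_poly) simp
  also have "(\<Sum>i<m. poly P (cos (y i))) = (\<Sum>i<m. if i \<in> {..<Suc q} then 1 else 0)"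
    by (intro sum.cong) (auto simp: node)
  also have "\<dots> = real (Suc q)"
    using sub by (subst sum.inter_restrict[symmetric]) (auto simp: Int_absorb1)
  finally have "((\<lambda>t. poly P (cos t) * 1) has_integral real (Suc q) * h) {0..pi}"
    by (simp add: h_def mult.commute)
  from E_integral[OF this] has_integral_const_real[of "1::real" 0 c] c
  have "((\<lambda>t. E t * 1) has_integral real (Suc q) * h - c) {0..pi}" by simp
  \<comment> \<open>The rule counts q + 1 nodes of weight h, while c = (q + 1/2) h; half a step
    remains.\<close>
  then have E1: "(E has_integral h / 2) {0..pi}" by (simp add: c_def algebra_simps)
  define I where "I = integral {0..pi} (\<lambda>t. poly P (cos t) * (sin t)\<^sup>2)"
  have I: "((\<lambda>t. poly P (cos t) * (sin t)\<^sup>2) has_integral I) {0..pi}"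
    unfolding I_def
    by (intro integrable_integral integrable_continuous_real continuous_intros)
  have "I \<le> pi / real m * (\<Sum>i<m. poly P (cos (y i)) * (sin (y i))\<^sup>2)"
    unfolding I_def y_def h_def
    by (rule quadrature_upper[OF deg coeff_top_nonneg[OF deg P0]]) (use m in simp)
  also have "(\<Sum>i<m. poly P (cos (y i)) * (sin (y i))\<^sup>2)
      = (\<Sum>i<m. if i \<in> {..<Suc q} then (sin (y i))\<^sup>2 else 0)"
    by (intro sum.cong) (auto simp: node)
  also have "\<dots> = (\<Sum>i<Suc q. (sin (y i))\<^sup>2)"
    using sub by (subst sum.inter_restrict[symmetric]) (auto simp: Int_absorb1)
  also have "pi / real m * \<dots> \<le> pi / 2 * semicircle_tail c + 6 * h * s\<^sup>2"
    using midpoint_sum_upper[OF m q] by (simp only: y_def h_def c_def s_def)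
  finally have I_le: "I \<le> pi / 2 * semicircle_tail c + 6 * h * s\<^sup>2" .
  have E2: "((\<lambda>t. E t * (sin t)\<^sup>2) has_integral I - pi / 2 * semicircle_tail c) {0..pi}"
    by (rule E_integral[OF I has_integral_sin_squared]) (use c in simp)
  show thesis
  proof (rule that[OF p P0])
    show "1 \<le> poly P x" if "cos c \<le> x" for x using P1 that yc by simp
    have "I = pi / 2 * p 0"
      using has_integral_unique[OF I] chebyshev_U_coefficient[OF p, of 0]
      by (simp add: power2_eq_square)
    then have "p 0 \<le> semicircle_tail c + 12 / pi * (h * s\<^sup>2)" using I_le by (simp add: field_simps)
    also have "12 / pi * (h * s\<^sup>2) \<le> 4 * (h * s\<^sup>2)"
      using h pi_gt3 by (intro mult_right_mono) (auto simp: field_simps)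
    finally show "p 0 \<le> semicircle_tail c + 4 * h * (sin c)\<^sup>2" by (simp add: s_def mult.assoc)
    fix n :: nat
    assume n: "0 < n" "n \<le> 2 * m - 2"
    obtain J where J: "((\<lambda>t. sin (real (n + 1) * t) * sin t) has_integral J) {0..c}"
      "\<bar>J\<bar> \<le> 2 * s / real n"
      using abs_integral_sin_mult_sin_le[of c n] c n s by (auto simp: s_def)
    let ?f = "\<lambda>t. E t * (sin (real (n + 1) * t) * sin t)"
    let ?g = "\<lambda>t. s / 2 * E t + 1 / (2 * s) * (E t * (sin t)\<^sup>2)"
    have f: "(?f has_integral pi / 2 * p n - J) {0..pi}"
      by (rule E_integral[OF chebyshev_U_coefficient[OF p n(2)] J(1)])
    have g: "(?g has_integral s / 2 * (h / 2) + 1 / (2 * s) * (I - pi / 2 * semicircle_tail c)) {0..pi}"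
      by (intro has_integral_add has_integral_mult_right E1 E2)
    have fg: "\<bar>?f t\<bar> \<le> ?g t" if t: "t \<in> {0..pi}" for t
    proof -
      have sn: "0 \<le> sin t" using t by (simp add: sin_ge_zero)
      have "\<bar>sin (real (n + 1) * t) * sin t\<bar> \<le> 1 * sin t"
        unfolding abs_mult using sn by (intro mult_mono) auto
      also have "1 * sin t \<le> s / 2 + 1 / (2 * s) * (sin t)\<^sup>2"
      proof -
        have "0 \<le> (s - sin t)\<^sup>2" by simp
        then show ?thesis using s by (simp add: power2_eq_square field_simps)
      qed
      finally have "E t * \<bar>sin (real (n + 1) * t) * sin t\<bar> \<le> E t * (s / 2 + 1 / (2 * s) * (sin t)\<^sup>2)"
        using E0[OF t] by (intro mult_left_mono)
      then show ?thesis using E0[OF t] by (simp add: abs_mult algebra_simps)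
    qed
    have "pi / 2 * p n - J \<le> s / 2 * (h / 2) + 1 / (2 * s) * (I - pi / 2 * semicircle_tail c)"
      by (rule has_integral_le[OF f g]) (use fg abs_le_D1 in blast)
    moreover have "- (pi / 2 * p n - J) \<le> s / 2 * (h / 2) + 1 / (2 * s) * (I - pi / 2 * semicircle_tail c)"
      by (rule has_integral_le[OF has_integral_neg[OF f] g]) (use fg abs_le_D2 in blast)
    ultimately have 1: "\<bar>pi / 2 * p n\<bar>
        \<le> 2 * s / real n + s / 2 * (h / 2) + 1 / (2 * s) * (I - pi / 2 * semicircle_tail c)"
      using J(2) by linarith
    also have "1 / (2 * s) * (I - pi / 2 * semicircle_tail c) \<le> 1 / (2 * s) * (6 * h * s\<^sup>2)"
      using I_le s by (intro mult_left_mono) auto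
    also have "1 / (2 * s) * (6 * h * s\<^sup>2) = 3 * (s * h)" using s by (simp add: power2_eq_square)
    finally have "\<bar>pi / 2 * p n\<bar> \<le> 2 * s / real n + 13 / 4 * (s * h)" by simp
    \<comment> \<open>The degree bound n \<le> 2 m - 2 enters here: it gives h \<le> 2 \<pi> / n, so
      the quadrature error is absorbed into O(s / n). The 13/4 is 1/4 from the integral of E plus 3
      from that of E sin^2.\<close>
    also have "s * h \<le> s * (2 * pi / real n)"
    proof -
      have "real n * h \<le> (2 * real m) * h" using n h by (intro mult_right_mono) auto
      then have "real n * h \<le> 2 * pi" using hm by simp
      then have "h \<le> 2 * pi / real n" using n by (simp add: pos_le_divide_eq mult.commute)
      then show ?thesis using s by (intro mult_left_mono) auto
    qed
    also have "2 * s / real n + 13 / 4 * (s * (2 * pi / real n)) = (2 + 13 / 2 * pi) * (s / real n)"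
      by (simp add: distrib_right add_divide_distrib)
    also have "\<dots> \<le> (9 * pi) * (s / real n)"
      using s pi_gt3 by (intro mult_right_mono) auto
    also have "\<dots> = pi / 2 * (18 * s / real n)" by simp
    finally show "\<bar>p n\<bar> \<le> 18 * sin c / real n"
      by (simp only: abs_mult abs_of_pos[OF pi_half_gt_zero]
          mult_le_cancel_left_pos[OF pi_half_gt_zero] s_def)
  qed
qed

section \<open>Transfer to arbitrary measures\<close>

text \<open>Every lower power is dominated by 1 + |x|^N, which is integrable because the total mass
  is finite.\<close>

lemma integrable_poly:
  fixes P :: "real poly"
  assumes "real_distribution M" "integrable M (\<lambda>x. \<bar>x\<bar> ^ N)" "degree P \<le> N"
  shows "integrable M (poly P)"
proof -
  interpret real_distribution M by fact
  have "integrable M (\<lambda>x. x ^ i)" if "i \<le> N" for i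
  proof (rule Bochner_Integration.integrable_bound)
    show "integrable M (\<lambda>x. 1 + \<bar>x\<bar> ^ N)" using assms(2) by simp
    show "(\<lambda>x. x ^ i) \<in> borel_measurable M" by measurable
    have "\<bar>x\<bar> ^ i \<le> 1 + \<bar>x\<bar> ^ N" for x :: real
    proof (cases "\<bar>x\<bar> \<le> 1")
      case True
      then show ?thesis using power_le_one[of "\<bar>x\<bar>" i] by (simp add: add_increasing2)
    next
      case False
      then show ?thesis using power_increasing[OF that, of "\<bar>x\<bar>"] by (intro add_increasing) auto
    qed
    then have "norm (x ^ i) \<le> norm (1 + \<bar>x\<bar> ^ N)" for x :: real
      unfolding real_norm_def power_abs by (rule order.trans[OF _ abs_ge_self])
    then show "AE x in M. norm (x ^ i) \<le> norm (1 + \<bar>x\<bar> ^ N)" by (intro AE_I2)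
  qed
  then have "integrable M (\<lambda>x. coeff P i * x ^ i)" if "i \<le> degree P" for i
    using that assms(3) by (intro integrable_mult_right) simp
  then have "integrable M (\<lambda>x. \<Sum>i\<le>degree P. coeff P i * x ^ i)"
    by (intro Bochner_Integration.integrable_sum) simp
  then show ?thesis by (simp only: poly_altdef[abs_def])
qed

text \<open>Integrates the majorant term by term. The term n = 0 contributes \<open>p 0\<close>,
  since U_0 = 1 and the mass is 1; the remaining terms are replaced by absolute values, so the sum
  may be extended to N.\<close>

lemma measure_atLeast_grid_le:
  fixes m q N :: nat and M :: "real measure"
  defines "h \<equiv> pi / real m"
  defines "c \<equiv> (real q + 1/2) * h"
  assumes m: "2 \<le> m" and q: "q < m" and N: "2 * m - 2 \<le> N"
    and M: "real_distribution M" and int: "integrable M (\<lambda>x. \<bar>x\<bar> ^ N)"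
  shows "measure M {cos c..} \<le> semicircle_tail c + 4 * h * (sin c)\<^sup>2
    + 18 * sin c * (\<Sum>n=1..N. 1 / real n * \<bar>\<integral>x. poly (chebyshev_U n) x \<partial>M\<bar>)"
proof -
  interpret real_distribution M by fact
  let ?u = "\<lambda>n. \<integral>x. poly (chebyshev_U n) x \<partial>M"
  obtain P p where P: "P = (\<Sum>n\<le>2 * m - 2. smult (p n) (chebyshev_U n))"
    and P0: "\<And>x. 0 \<le> poly P x" and P1: "\<And>x. cos c \<le> x \<Longrightarrow> 1 \<le> poly P x"
    and p0: "p 0 \<le> semicircle_tail c + 4 * h * (sin c)\<^sup>2"
    and pn: "\<And>n. 0 < n \<Longrightarrow> n \<le> 2 * m - 2 \<Longrightarrow> \<bar>p n\<bar> \<le> 18 * sin c / real n"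
    using one_sided_chebyshev_U[OF m q, folded h_def, folded c_def] by blast
  have s: "0 \<le> 18 * sin c"
    using order.trans[OF abs_ge_zero pn[of 1]] m by simp
  have U: "integrable M (poly (chebyshev_U n))" if "n \<le> 2 * m - 2" for n
    using chebyshev_U_degree_coeff[of n] that N by (intro integrable_poly[OF M int]) auto
  have Px: "poly P x = (\<Sum>n\<le>2 * m - 2. p n * poly (chebyshev_U n) x)" for x
    by (simp add: P poly_sum)
  have "integrable M (poly P)"
    unfolding Px[abs_def] by (intro Bochner_Integration.integrable_sum integrable_mult_right U) auto
  moreover have "measure M {cos c..} = (\<integral>x. indicator {cos c..} x \<partial>M)" by simp
  moreover have "\<dots> \<le> (\<integral>x. poly P x \<partial>M)"
    using calculation(1)
    by (intro integral_mono integrable_real_indicator) (auto simp: indicator_def P0 P1 less_top[symmetric])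
  ultimately have "measure M {cos c..} \<le> (\<integral>x. poly P x \<partial>M)" by linarith
  also have "\<dots> = (\<Sum>n\<le>2 * m - 2. p n * ?u n)"
    unfolding Px by (subst Bochner_Integration.integral_sum) (auto intro!: U)
  also have "\<dots> = p 0 + (\<Sum>n=1..2 * m - 2. p n * ?u n)"
  proof -
    have "poly (chebyshev_U 0) = (\<lambda>_. 1)" by (simp add: fun_eq_iff chebyshev_U_0)
    then show ?thesis by (simp add: atMost_atLeast0 sum.atLeast_Suc_atMost prob_space[simplified])
  qed
  also have "(\<Sum>n=1..2 * m - 2. p n * ?u n) \<le> (\<Sum>n=1..2 * m - 2. 18 * sin c * (1 / real n * \<bar>?u n\<bar>))"
  proof (rule sum_mono)
    fix n assume n: "n \<in> {1..2 * m - 2}"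
    have "p n * ?u n \<le> \<bar>p n\<bar> * \<bar>?u n\<bar>" by (metis abs_ge_self abs_mult)
    also have "\<dots> \<le> 18 * sin c / real n * \<bar>?u n\<bar>" using pn[of n] n by (intro mult_right_mono) auto
    finally show "p n * ?u n \<le> 18 * sin c * (1 / real n * \<bar>?u n\<bar>)" by simp
  qed
  also have "\<dots> \<le> (\<Sum>n=1..N. 18 * sin c * (1 / real n * \<bar>?u n\<bar>))"
    using s N by (intro sum_mono2 mult_nonneg_nonneg) auto
  finally show ?thesis using p0 by (simp add: sum_distrib_left)
qed

text \<open>On [-1, 1] the squared sine is (1 - |x|)(1 + |x|); outside it is 0. This converts bounds
  in sin \<theta> into bounds in \<open>edge_rho\<close>.\<close>

lemma sin_clamp_arccos_le: "\<bar>sin (clamp_arccos x)\<bar> \<le> 2 * sqrt (edge_rho x N)"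
proof (rule power2_le_imp_le)
  have "(sin (clamp_arccos x))\<^sup>2 \<le> 4 * edge_rho x N"
  proof (cases "\<bar>x\<bar> \<le> 1")
    case True
    then have "max (- 1) (min 1 x) = x" by auto
    then have "(sin (clamp_arccos x))\<^sup>2 = 1 - x\<^sup>2" by (simp only: sin_squared_eq cos_clamp_arccos)
    also have "\<dots> = (1 - \<bar>x\<bar>) * (1 + \<bar>x\<bar>)"
      by (simp add: algebra_simps power2_eq_square)
    also have "\<dots> \<le> (1 - \<bar>x\<bar>) * 4" using True by (intro mult_left_mono) auto
    also have "\<dots> \<le> edge_rho x N * 4" by (intro mult_right_mono) (auto simp: edge_rho_def)
    finally show ?thesis by simp
  next
    case False
    then have "(sin (clamp_arccos x))\<^sup>2 = 0"
      unfolding sin_squared_eq cos_clamp_arccos by (auto simp: max_def min_def)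
    moreover have "0 \<le> edge_rho x N" by (simp add: edge_rho_def max.coboundedI2)
    ultimately show ?thesis by simp
  qed
  moreover have "0 \<le> edge_rho x N" by (simp add: edge_rho_def max.coboundedI2)
  ultimately show "\<bar>sin (clamp_arccos x)\<bar>\<^sup>2 \<le> (2 * sqrt (edge_rho x N))\<^sup>2"
    by (simp add: power_mult_distrib)
qed (simp add: edge_rho_def max.coboundedI2)

text \<open>The angle of x is rounded up to a grid angle c, a move by at most h = O(1 / N). Since
  \<open>edge_rho\<close> is at least N^(-2), h is also O(R), so the sine stays O(R) along the way,
  and both the mass passed over and the error h sin^2 c are O(R^2 / N).\<close>

lemma measure_atLeast_le:
  fixes M :: "real measure" and N :: nat
  assumes N: "1 \<le> N" and M: "real_distribution M" and int: "integrable M (\<lambda>x. \<bar>x\<bar> ^ N)"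
  shows "measure M {x..} - measure semicircle {x..}
    \<le> 4000 * (edge_rho x N / real N + sqrt (edge_rho x N)
        * (\<Sum>n=1..N. 1 / real n * \<bar>\<integral>x. poly (chebyshev_U n) x \<partial>M\<bar>))"
    (is "_ \<le> 4000 * (?r / _ + _ * ?S)")
proof -
  interpret real_distribution M by fact
  define R where "R = sqrt ?r"
  define X where "X = ?r / real N"
  define S where "S = ?S"
  define \<theta> where "\<theta> = clamp_arccos x"
  have r: "1 / (real N)\<^sup>2 \<le> ?r" by (simp add: edge_rho_def)
  then have r0: "0 \<le> ?r" by (rule order.trans[rotated]) simp
  have R: "0 \<le> R" "R\<^sup>2 = ?r" using r0 by (simp_all add: R_def)
  have RN: "1 / real N \<le> R"
    unfolding R_def using r by (intro real_le_rsqrt) (simp add: power_divide)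
  have X: "0 \<le> X" using r0 by (simp add: X_def)
  have S: "0 \<le> S" unfolding S_def by (intro sum_nonneg) auto
  then have RS: "0 \<le> R * S" using R(1) by simp
  have \<theta>: "0 \<le> \<theta>" "\<theta> \<le> pi" "\<bar>sin \<theta>\<bar> \<le> 2 * R"
    by (simp_all add: \<theta>_def clamp_arccos_bounds sin_clamp_arccos_le R_def)
  have sc: "measure semicircle {x..} = semicircle_tail \<theta>" by (simp add: measure_semicircle \<theta>_def)
  have "measure M {x..} - measure semicircle {x..} \<le> 4000 * (X + R * S)"
  proof (cases "N = 1")
    \<comment> \<open>Here \<open>edge_rho\<close> is at least 1, so the trivial bound suffices; the
      grid below would have only one node.\<close>
    case True
    have "measure M {x..} - measure semicircle {x..} \<le> 1"
      using prob_le_1[of "{x..}"] measure_nonneg[of semicircle "{x..}"] by linarith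
    moreover have "1 \<le> X" using r True by (simp add: X_def)
    ultimately show ?thesis using RS unfolding distrib_left by linarith
  next
    case False
    \<comment> \<open>The largest m with 2 m - 2 \<le> N, so that the majorant needs no moments
      beyond order N.\<close>
    define m where "m = N div 2 + 1"
    define h where "h = pi / real m"
    have m: "2 \<le> m" "2 * m - 2 \<le> N" "N \<le> 2 * m" using N False by (auto simp: m_def)
    have h: "0 < h" "real m * h = pi" using m by (simp_all add: h_def)
    have hN: "h \<le> 8 / real N"
    proof -
      have "h * real N \<le> h * (2 * real m)" using h m by (intro mult_left_mono) auto
      also have "\<dots> \<le> 8" using h pi_less_4 by (simp add: mult.left_commute mult.commute)
      finally show ?thesis using N by (simp add: pos_le_divide_eq)
    qed
    then have hR: "h \<le> 8 * R" using RN by simp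
    have sin: "\<bar>sin t\<bar> \<le> 10 * R" if "\<theta> \<le> t" "t \<le> \<theta> + h" for t
      using abs_sin_add_le[of \<theta> "t - \<theta>"] abs_sin_x_le_abs_x[of "t - \<theta>"] \<theta>(3) hR that by simp
    have area: "h * (10 * R)\<^sup>2 \<le> 800 * X"
      using mult_right_mono[OF hN, of "100 * R\<^sup>2"] r0 by (simp add: R(2) X_def power_mult_distrib)
    have tail: "semicircle_tail t - semicircle_tail \<theta> \<le> 800 * X"
      if "\<theta> \<le> t" "t \<le> \<theta> + h" for t
    proof -
      have "semicircle_tail t - semicircle_tail \<theta> \<le> 2 / pi * ((t - \<theta>) * (10 * R)\<^sup>2)"
        by (rule semicircle_tail_diff_le) (use that sin in auto)
      also have "\<dots> \<le> 1 * (h * (10 * R)\<^sup>2)"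
        using that pi_gt3 by (intro mult_mono mult_right_mono) auto
      finally show ?thesis using area by simp
    qed
    show ?thesis
    proof (cases "\<theta> \<le> pi - h / 2")
      case True
      \<comment> \<open>The first grid angle at or after \<theta>; it exists because \<theta> does
        not exceed the last one, \<pi> - h / 2.\<close>
      define q where "q = nat \<lceil>\<theta> / h - 1/2\<rceil>"
      define c where "c = (real q + 1/2) * h"
      have "\<theta> \<le> (real m - 1/2) * h" using True h(2) by (simp add: left_diff_distrib)
      then have "\<theta> / h \<le> real m - 1/2" using h(1) by (simp add: pos_divide_le_eq)
      then have "\<lceil>\<theta> / h - 1/2\<rceil> \<le> int m - 1" by (intro ceiling_le) simp
      then have q: "q < m" using m unfolding q_def by linarith
      have "\<theta> / h \<le> real q + 1/2"
        using real_nat_ceiling_ge[of "\<theta> / h - 1/2"] by (simp add: q_def)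
      then have c1: "\<theta> \<le> c" using h(1) by (simp add: c_def pos_divide_le_eq)
      have "0 \<le> \<theta> / h" using \<theta>(1) h(1) by simp
      then have "real q \<le> \<theta> / h + 1/2"
        using ceiling_correct[of "\<theta> / h - 1/2"] unfolding q_def
        by (cases "0 \<le> \<lceil>\<theta> / h - 1/2\<rceil>") auto
      then have "real q + 1/2 \<le> (\<theta> + h) / h" using h(1) by (simp add: add_divide_distrib)
      then have c2: "c \<le> \<theta> + h" using h(1) by (simp add: c_def pos_le_divide_eq)
      have "c \<le> real m * h" unfolding c_def using q h(1) by (intro mult_right_mono) auto
      then have c_pi: "c \<le> pi" using h(2) by simp
      have "cos c \<le> cos \<theta>" using c1 c_pi \<theta> by (intro cos_monotone_0_pi_le) auto
      moreover have "cos pi < cos \<theta>" using True h(1) \<theta> by (intro cos_monotone_0_pi) auto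
      \<comment> \<open>Clamping can raise x only if x < -1, that is for \<theta> = \<pi>, which the
        present case excludes.\<close>
      moreover have "cos \<theta> \<le> - 1 \<or> cos \<theta> \<le> x"
        unfolding \<theta>_def cos_clamp_arccos by (auto simp: max_def min_def)
      ultimately have "cos c \<le> x" by auto
      then have "measure M {x..} \<le> measure M {cos c..}" by (intro finite_measure_mono) auto
      also have "\<dots> \<le> semicircle_tail c + 4 * h * (sin c)\<^sup>2 + 18 * sin c * S"
        using measure_atLeast_grid_le[OF m(1) q m(2) M int] by (simp only: c_def h_def S_def)
      finally have 1: "measure M {x..} \<le> semicircle_tail c + 4 * h * (sin c)\<^sup>2 + 18 * sin c * S" .
      have "(sin c)\<^sup>2 \<le> (10 * R)\<^sup>2" using power_mono[OF sin[OF c1 c2], of 2] by simp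
      then have "h * (sin c)\<^sup>2 \<le> h * (10 * R)\<^sup>2" using h(1) by (intro mult_left_mono) auto
      then have 2: "4 * h * (sin c)\<^sup>2 \<le> 3200 * X" using area by linarith
      have "sin c * S \<le> 10 * R * S" using sin[OF c1 c2] S by (intro mult_right_mono) auto
      then have "18 * sin c * S \<le> 180 * (R * S)" unfolding mult.assoc by linarith
      \<comment> \<open>The constant 4000 is 800 from rounding the angle plus 3200 from the grid
        error.\<close>
      with 1 2 tail[OF c1 c2]
      have "measure M {x..} - semicircle_tail \<theta> \<le> 4000 * X + 180 * (R * S)" by linarith
      then show ?thesis using RS unfolding sc distrib_left by linarith
    next
      case False
      \<comment> \<open>Past the last grid angle the semicircle mass is already within O(X) of 1, so
        bounding the other measure by 1 is enough.\<close>
      have "semicircle_tail pi - semicircle_tail \<theta> \<le> 800 * X"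
        using False \<theta> h(1) by (intro tail) auto
      moreover have "semicircle_tail pi = 1" by (simp add: semicircle_tail_def)
      moreover have "measure M {x..} \<le> 1" by (rule prob_le_1)
      ultimately show ?thesis using RS X unfolding sc distrib_left by linarith
    qed
  qed
  then show ?thesis by (simp only: R_def X_def S_def)
qed

theorem proposition5:
  shows "\<exists>K::real. K > 0 \<and>
    (\<forall>(n0::nat) (M::real measure) (x0::real).
       n0 \<ge> 1 \<longrightarrow> real_distribution M \<longrightarrow> integrable M (\<lambda>x. \<bar>x\<bar> ^ n0) \<longrightarrow>
       \<bar>measure M {x0..} - measure semicircle {x0..}\<bar>
         \<le> K * (edge_rho x0 n0 / real n0
                + sqrt (edge_rho x0 n0)
                  * (\<Sum>n=1..n0. 1 / real n * \<bar>\<integral>x. poly (chebyshev_U n) x \<partial>M\<bar>)))"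
proof (intro exI[of _ 4000] conjI allI impI)
  fix N :: nat and M :: "real measure" and x :: real
  assume N: "1 \<le> N" and M: "real_distribution M" and int: "integrable M (\<lambda>x. \<bar>x\<bar> ^ N)"
  interpret real_distribution M by fact
  \<comment> \<open>Reflection turns the lower bound into an upper bound at -x; by parity of U_n,
    the absolute values of its integrals are unchanged.\<close>
  define M' where "M' = distr M borel uminus"
  have M': "real_distribution M'" unfolding M'_def by (rule real_distribution_distr) simp
  have int': "integrable M' (\<lambda>x. \<bar>x\<bar> ^ N)"
    unfolding M'_def using int by (subst integrable_distr_eq) auto
  have "\<bar>\<integral>x. poly (chebyshev_U n) x \<partial>M'\<bar> = \<bar>\<integral>x. poly (chebyshev_U n) x \<partial>M\<bar>" for n
  proof -
    have "(\<integral>x. poly (chebyshev_U n) x \<partial>M') = (\<integral>x. poly (chebyshev_U n) (- x) \<partial>M)"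
      unfolding M'_def by (subst integral_distr) (auto intro!: borel_measurable_continuous_onI continuous_intros)
    then show ?thesis by (simp add: chebyshev_U_minus abs_mult)
  qed
  moreover have "edge_rho (- x) N = edge_rho x N" by (simp add: edge_rho_def)
  ultimately have lower: "measure M' {- x..} - measure semicircle {- x..}
      \<le> 4000 * (edge_rho x N / real N + sqrt (edge_rho x N)
          * (\<Sum>n=1..N. 1 / real n * \<bar>\<integral>x. poly (chebyshev_U n) x \<partial>M\<bar>))"
    (is "_ \<le> ?B")
    using measure_atLeast_le[OF N M' int', of "- x"] by (simp only:)
  have "1 - measure M {x..} = measure M {..<x}"
  proof -
    have "{..<x} = space M - {x..}" by auto
    then show ?thesis using prob_compl[of "{x..}"] by simp
  qed
  \<comment> \<open>A possible atom of \<open>M\<close> at x only helps, and the semicircle law has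
    none.\<close>
  also have "\<dots> \<le> measure M {..x}" by (intro finite_measure_mono) auto
  also have "\<dots> = measure M' {- x..}"
  proof -
    have "uminus -` {- x..} \<inter> space M = {..x}" by auto
    then show ?thesis unfolding M'_def by (subst measure_distr) auto
  qed
  finally have "measure semicircle {x..} - measure M {x..}
      \<le> measure M' {- x..} - measure semicircle {- x..}"
    unfolding measure_semicircle_minus by simp
  also note lower
  finally have "measure semicircle {x..} - measure M {x..} \<le> ?B" .
  moreover have "measure M {x..} - measure semicircle {x..} \<le> ?B"
    by (rule measure_atLeast_le[OF N M int])
  ultimately show "\<bar>measure M {x..} - measure semicircle {x..}\<bar> \<le> ?B"
    by (simp only: abs_le_iff minus_diff_eq)
qed simp

end
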